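(* Let $G$ be a CT group. Then $G$ is not CSA if and only if $G$ contains a nonabelian subgroup $G_0$ which itself contains a nontrivial abelian subgroup $H$ that is normal in $G_0$.
   Context: A group $G$ is CT (commutative transitive) if for all nontrivial $x,y,z \in G$, $[x,y]=1$ and $[y,z]=1$ imply $[x,z]=1$. A subgroup $H$ of a group $G$ is malnormal in $G$ if $g^{-1}Hg \cap H = \{1\}$ for every $g \in G \setminus H$. A group $G$ is CSA (conjugately separated abelian) if every maximal abelian subgroup of $G$ is malnormal in $G$. *)

theory Defs
  imports "HOL-Algebra.Coset"
begin

definition commutator :: "('a, 'b) monoid_scheme \<Rightarrow> 'a \<Rightarrow> 'a \<Rightarrow> 'a"
  where "commutator G x y = inv\<^bsub>G\<^esub> x \<otimes>\<^bsub>G\<^esub> inv\<^bsub>G\<^esub> y \<otimes>\<^bsub>G\<^esub> x \<otimes>\<^bsub>G\<^esub> y"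

definition CT_group :: "('a, 'b) monoid_scheme \<Rightarrow> bool"
  where "CT_group G \<longleftrightarrow> group G \<and>
    (\<forall>x \<in> carrier G - {\<one>\<^bsub>G\<^esub>}. \<forall>y \<in> carrier G - {\<one>\<^bsub>G\<^esub>}. \<forall>z \<in> carrier G - {\<one>\<^bsub>G\<^esub>}.
       commutator G x y = \<one>\<^bsub>G\<^esub> \<longrightarrow> commutator G y z = \<one>\<^bsub>G\<^esub> \<longrightarrow> commutator G x z = \<one>\<^bsub>G\<^esub>)"

definition abelian_subgroup :: "'a set \<Rightarrow> ('a, 'b) monoid_scheme \<Rightarrow> bool"
  where "abelian_subgroup H G \<longleftrightarrow> subgroup H G \<and> comm_group (G\<lparr>carrier := H\<rparr>)"

definition maximal_abelian_subgroup :: "'a set \<Rightarrow> ('a, 'b) monoid_scheme \<Rightarrow> bool"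
  where "maximal_abelian_subgroup M G \<longleftrightarrow> abelian_subgroup M G \<and>
    (\<forall>K. abelian_subgroup K G \<longrightarrow> M \<subseteq> K \<longrightarrow> K = M)"

definition malnormal :: "'a set \<Rightarrow> ('a, 'b) monoid_scheme \<Rightarrow> bool"
  where "malnormal H G \<longleftrightarrow> subgroup H G \<and>
    (\<forall>g \<in> carrier G - H. ((inv\<^bsub>G\<^esub> g <#\<^bsub>G\<^esub> H) #>\<^bsub>G\<^esub> g) \<inter> H = {\<one>\<^bsub>G\<^esub>})"

definition CSA_group :: "('a, 'b) monoid_scheme \<Rightarrow> bool"
  where "CSA_group G \<longleftrightarrow> group G \<and> (\<forall>M. maximal_abelian_subgroup M G \<longrightarrow> malnormal M G)"

end

theory Submission
  imports Defs "HOL-Algebra.Zassenhaus"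
begin

text \<open>
  In a CT group the centralizer of a nontrivial element is abelian, so it is a maximal abelian
  subgroup, and every nontrivial maximal abelian subgroup is the centralizer of each of its
  nontrivial elements (\<open>maximal_abelian_eq_centralizer\<close>).

  Suppose a maximal abelian subgroup \<open>M\<close> fails to be malnormal: some \<open>g\<close> outside \<open>M\<close> has a
  nontrivial \<open>h\<close> in \<open>M\<close> with \<open>k = g \<otimes> h \<otimes> inv g\<close> also in \<open>M\<close>. Conjugation by \<open>g\<close> carries the
  centralizer of \<open>h\<close> to that of \<open>k\<close>, and both are \<open>M\<close>; hence \<open>g\<close> normalizes \<open>M\<close>
  (\<open>maximal_abelian_normalizer\<close>). The normalizer of \<open>M\<close> is then strictly larger than \<open>M\<close>, so by
  maximality it is nonabelian, and \<open>M\<close> is the required normal subgroup of it.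

  Conversely, let \<open>H\<close> be nontrivial, abelian and normal in a nonabelian \<open>G0\<close>, and take \<open>h \<noteq> \<one>\<close> in
  \<open>H\<close>. The centralizer \<open>M\<close> of \<open>h\<close> is maximal abelian and contains \<open>H\<close>, but it cannot contain the
  nonabelian \<open>G0\<close>. For \<open>g\<close> in \<open>G0\<close> outside \<open>M\<close>, the conjugate \<open>g \<otimes> h \<otimes> inv g\<close> is nontrivial and
  lies in \<open>H\<close>, thus in \<open>M\<close>, so \<open>M\<close> is not malnormal.
\<close>

definition centralizer :: "('a, 'b) monoid_scheme \<Rightarrow> 'a \<Rightarrow> 'a set"
  where "centralizer G h = {x \<in> carrier G. x \<otimes>\<^bsub>G\<^esub> h = h \<otimes>\<^bsub>G\<^esub> x}"

context group
begin

lemma commutator_eq_one_iff: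
  assumes "x \<in> carrier G" "y \<in> carrier G"
  shows "commutator G x y = \<one> \<longleftrightarrow> x \<otimes> y = y \<otimes> x"
proof -
  have "commutator G x y = inv (y \<otimes> x) \<otimes> (x \<otimes> y)"
    using assms by (simp add: commutator_def inv_mult_group m_assoc)
  then show ?thesis
    using assms by (metis inv_closed inv_equality inv_inv l_inv m_closed)
qed

lemma abelian_subgroup_iff:
  "abelian_subgroup H G \<longleftrightarrow> subgroup H G \<and> (\<forall>x\<in>H. \<forall>y\<in>H. x \<otimes> y = y \<otimes> x)"
proof (cases "subgroup H G")
  case True
  have "comm_group (G\<lparr>carrier := H\<rparr>) \<longleftrightarrow> (\<forall>x\<in>H. \<forall>y\<in>H. x \<otimes> y = y \<otimes> x)"
    using comm_groupE(4)[of "G\<lparr>carrier := H\<rparr>"]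
      group.group_comm_groupI[OF subgroup_imp_group[OF True]] by auto
  then show ?thesis
    using True by (simp add: abelian_subgroup_def)
qed (simp add: abelian_subgroup_def)

lemma commute_conjugate:
  assumes "g \<in> carrier G" "x \<in> carrier G" "y \<in> carrier G" "x \<otimes> y = y \<otimes> x"
  shows "(g \<otimes> x \<otimes> inv g) \<otimes> (g \<otimes> y \<otimes> inv g) = (g \<otimes> y \<otimes> inv g) \<otimes> (g \<otimes> x \<otimes> inv g)"
proof -
  have conj_mult: "(g \<otimes> a \<otimes> inv g) \<otimes> (g \<otimes> b \<otimes> inv g) = g \<otimes> (a \<otimes> b) \<otimes> inv g"
    if "a \<in> carrier G" "b \<in> carrier G" for a b
    using that assms(1) by (simp add: m_assoc inv_solve_left')
  show ?thesis
    using assms by (simp add: conj_mult)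
qed

lemma subgroup_centralizer:
  assumes "h \<in> carrier G"
  shows "subgroup (centralizer G h) G"
proof (rule subgroupI)
  show "centralizer G h \<subseteq> carrier G" "centralizer G h \<noteq> {}"
    using assms by (auto simp: centralizer_def)
next
  fix a assume "a \<in> centralizer G h"
  then have a: "a \<in> carrier G" "a \<otimes> h = h \<otimes> a" by (auto simp: centralizer_def)
  then have "h \<otimes> inv a = inv a \<otimes> h"
    using assms by (metis inv_closed inv_solve_left inv_solve_right m_assoc m_closed)
  then show "inv a \<in> centralizer G h" using a by (simp add: centralizer_def)
next
  fix a b assume "a \<in> centralizer G h" "b \<in> centralizer G h"
  then show "a \<otimes> b \<in> centralizer G h"
    using assms by (simp add: centralizer_def) (metis m_assoc)
qed

lemma mem_conjugate_iff:
  assumes "H \<subseteq> carrier G" "g \<in> carrier G" "x \<in> carrier G"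
  shows "x \<in> g <# H #> inv g \<longleftrightarrow> inv g \<otimes> x \<otimes> g \<in> H"
proof
  assume "x \<in> g <# H #> inv g"
  then obtain h where h: "h \<in> H" "x = g \<otimes> h \<otimes> inv g"
    by (auto simp: l_coset_def r_coset_def)
  then have "h \<in> carrier G"
    using assms by auto
  with h assms have "inv g \<otimes> x \<otimes> g = h"
    by (simp add: m_assoc inv_solve_left')
  with h show "inv g \<otimes> x \<otimes> g \<in> H" by simp
next
  assume *: "inv g \<otimes> x \<otimes> g \<in> H"
  have "g \<otimes> (inv g \<otimes> x) = x"
    using assms by (simp add: m_assoc[symmetric])
  then have "x = g \<otimes> (inv g \<otimes> x \<otimes> g) \<otimes> inv g"
    using assms by (simp add: m_assoc)
  with * show "x \<in> g <# H #> inv g"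
    by (auto simp: l_coset_def r_coset_def)
qed

lemma mem_normalizerI:
  assumes "subgroup H G" "g \<in> carrier G"
    and "\<And>x. x \<in> H \<Longrightarrow> g \<otimes> x \<otimes> inv g \<in> H" "\<And>x. x \<in> H \<Longrightarrow> inv g \<otimes> x \<otimes> g \<in> H"
  shows "g \<in> normalizer G H"
proof -
  have H: "H \<subseteq> carrier G"
    by (rule subgroup.subset[OF assms(1)])
  have "g <# H #> inv g = H"
  proof
    show "g <# H #> inv g \<subseteq> H"
      using assms(3) by (auto simp: l_coset_def r_coset_def)
    show "H \<subseteq> g <# H #> inv g"
      using mem_conjugate_iff[OF H assms(2)] assms(4) H by blast
  qed
  then show ?thesis
    using assms(2) H by (simp add: normalizer_def stabilizer_def)
qed

lemma not_malnormalE: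
  assumes "subgroup H G" "\<not> malnormal H G"
  obtains g h where "g \<in> carrier G" "g \<notin> H" "h \<in> H" "h \<noteq> \<one>" "g \<otimes> h \<otimes> inv g \<in> H"
proof -
  have H: "H \<subseteq> carrier G"
    by (rule subgroup.subset[OF assms(1)])
  obtain g where g: "g \<in> carrier G" "g \<notin> H" "(inv g <# H #> g) \<inter> H \<noteq> {\<one>}"
    using assms by (auto simp: malnormal_def)
  have conj: "x \<in> inv g <# H #> g \<longleftrightarrow> g \<otimes> x \<otimes> inv g \<in> H" if "x \<in> carrier G" for x
    using mem_conjugate_iff[OF H, of "inv g" x] g that by simp
  have "\<one> \<in> (inv g <# H #> g) \<inter> H"
    using g subgroup.one_closed[OF assms(1)] by (simp add: conj)
  with g obtain h where "h \<in> (inv g <# H #> g) \<inter> H" "h \<noteq> \<one>" by blast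
  then show ?thesis
    using that[of g h] g conj H by blast
qed

lemma malnormalD:
  assumes "malnormal H G" "g \<in> carrier G" "h \<in> H" "g \<otimes> h \<otimes> inv g \<in> H" "h \<noteq> \<one>"
  shows "g \<in> H"
proof (rule ccontr)
  assume "g \<notin> H"
  have H: "H \<subseteq> carrier G"
    using assms(1) by (simp add: malnormal_def subgroup.subset)
  have "h \<in> inv g <# H #> g"
    using mem_conjugate_iff[OF H, of "inv g" h] assms H by auto
  moreover have "(inv g <# H #> g) \<inter> H = {\<one>}"
    using assms(1,2) \<open>g \<notin> H\<close> by (simp add: malnormal_def)
  ultimately show False using assms(3,5) by blast
qed

text \<open>Transitivity is only available through a nontrivial middle element, here \<open>h\<close>; a trivial
  \<open>x\<close> or \<open>y\<close> commutes with everything for free.\<close>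

lemma abelian_centralizer:
  assumes "CT_group G" "h \<in> carrier G" "h \<noteq> \<one>"
  shows "abelian_subgroup (centralizer G h) G"
  unfolding abelian_subgroup_iff
proof (intro conjI ballI)
  fix x y assume "x \<in> centralizer G h" "y \<in> centralizer G h"
  then have xy: "x \<in> carrier G" "y \<in> carrier G" "x \<otimes> h = h \<otimes> x" "h \<otimes> y = y \<otimes> h"
    by (auto simp: centralizer_def)
  show "x \<otimes> y = y \<otimes> x"
  proof (cases "x = \<one> \<or> y = \<one>")
    case False
    have "commutator G x h = \<one>" "commutator G h y = \<one>"
      using xy assms(2) by (simp_all add: commutator_eq_one_iff)
    then have "commutator G x y = \<one>"
      using assms xy False unfolding CT_group_def by blast
    then show ?thesis using xy by (simp add: commutator_eq_one_iff)
  qed (use xy in auto)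
qed (rule subgroup_centralizer[OF assms(2)])

lemma abelian_subgroup_le_centralizer:
  assumes "abelian_subgroup H G" "h \<in> H"
  shows "H \<subseteq> centralizer G h"
  using assms subgroup.subset[of H G] by (auto simp: abelian_subgroup_iff centralizer_def)

text \<open>Any abelian subgroup above the centralizer contains \<open>h\<close>, so it centralizes \<open>h\<close>.\<close>

lemma maximal_abelian_centralizer:
  assumes "CT_group G" "h \<in> carrier G" "h \<noteq> \<one>"
  shows "maximal_abelian_subgroup (centralizer G h) G"
proof -
  have "h \<in> centralizer G h" using assms(2) by (simp add: centralizer_def)
  then show ?thesis
    using abelian_centralizer[OF assms] abelian_subgroup_le_centralizer
    unfolding maximal_abelian_subgroup_def by blast
qed

lemma maximal_abelian_eq_centralizer:
  assumes "CT_group G" "maximal_abelian_subgroup M G" "h \<in> M" "h \<noteq> \<one>"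
  shows "M = centralizer G h"
proof -
  have M: "abelian_subgroup M G" using assms(2) by (simp add: maximal_abelian_subgroup_def)
  then have "h \<in> carrier G"
    using assms(3) subgroup.subset by (auto simp: abelian_subgroup_def)
  then show ?thesis
    using assms abelian_centralizer abelian_subgroup_le_centralizer[OF M]
    unfolding maximal_abelian_subgroup_def by metis
qed

text \<open>Both \<open>h\<close> and its conjugate \<open>k\<close> have centralizer \<open>M\<close>, so membership in \<open>M\<close> can be tested
  against either one; conjugation by \<open>g\<close> turns commuting with \<open>h\<close> into commuting with \<open>k\<close>, and
  conjugation by \<open>inv g\<close> goes back.\<close>

lemma maximal_abelian_normalizer:
  assumes "CT_group G" "maximal_abelian_subgroup M G" "g \<in> carrier G"
    and "h \<in> M" "h \<noteq> \<one>" "g \<otimes> h \<otimes> inv g \<in> M"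
  shows "g \<in> normalizer G M"
proof -
  define k where "k = g \<otimes> h \<otimes> inv g"
  have M: "subgroup M G"
    using assms(2) by (simp add: maximal_abelian_subgroup_def abelian_subgroup_def)
  have in_G: "x \<in> carrier G" if "x \<in> M" for x
    by (rule subgroup.mem_carrier[OF M that])
  have k: "k \<in> M" using assms(6) by (simp add: k_def)
  have h: "inv g \<otimes> k \<otimes> g = h"
    using assms(3) in_G[OF assms(4)] by (simp add: k_def m_assoc inv_solve_left')
  have "k \<noteq> \<one>" using h assms(3,5) by auto
  have Mh: "M = centralizer G h" and Mk: "M = centralizer G k"
    using maximal_abelian_eq_centralizer[OF assms(1,2)] assms(4,5) k \<open>k \<noteq> \<one>\<close> by auto
  show ?thesis
  proof (rule mem_normalizerI[OF M assms(3)])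
    fix x assume x: "x \<in> M"
    have "x \<otimes> h = h \<otimes> x" using x Mh by (simp add: centralizer_def)
    then have "g \<otimes> x \<otimes> inv g \<in> centralizer G k"
      using commute_conjugate[OF assms(3) in_G[OF x] in_G[OF assms(4)]] assms(3) in_G[OF x]
      by (simp add: centralizer_def k_def)
    then show "g \<otimes> x \<otimes> inv g \<in> M" using Mk by simp
    have "x \<otimes> k = k \<otimes> x" using x Mk by (simp add: centralizer_def)
    then have "inv g \<otimes> x \<otimes> g \<in> centralizer G h"
      using commute_conjugate[of "inv g" x k] assms(3) in_G[OF x] in_G[OF k]
      by (simp add: centralizer_def h)
    then show "inv g \<otimes> x \<otimes> g \<in> M" using Mh by simp
  qed
qed

end

theorem theorem4p1:
  fixes G :: "('a, 'b) monoid_scheme"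
  assumes "CT_group G"
  shows "\<not> CSA_group G \<longleftrightarrow>
    (\<exists>G0 H. subgroup G0 G \<and> \<not> abelian_subgroup G0 G \<and>
      H \<noteq> {\<one>\<^bsub>G\<^esub>} \<and> abelian_subgroup H (G\<lparr>carrier := G0\<rparr>) \<and>
      H \<lhd> (G\<lparr>carrier := G0\<rparr>))"
proof -
  interpret group G using assms by (simp add: CT_group_def)
  show ?thesis
  proof
    assume "\<not> CSA_group G"
    then obtain M where M: "maximal_abelian_subgroup M G" "\<not> malnormal M G"
      using is_group by (auto simp: CSA_group_def)
    then have abM: "abelian_subgroup M G" and subM: "subgroup M G"
      by (simp_all add: maximal_abelian_subgroup_def abelian_subgroup_def)
    obtain g h where g: "g \<in> carrier G" "g \<notin> M"
      and h: "h \<in> M" "h \<noteq> \<one>\<^bsub>G\<^esub>" "g \<otimes>\<^bsub>G\<^esub> h \<otimes>\<^bsub>G\<^esub> inv\<^bsub>G\<^esub> g \<in> M"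
      using not_malnormalE[OF subM M(2)] .
    let ?N = "normalizer G M"
    have N: "subgroup ?N G"
      by (rule normalizer_imp_subgroup[OF subgroup.subset[OF subM]])
    have normM: "M \<lhd> (G\<lparr>carrier := ?N\<rparr>)"
      by (rule subgroup_in_normalizer[OF subM])
    have subN: "subgroup M (G\<lparr>carrier := ?N\<rparr>)"
      by (rule normal_imp_subgroup[OF normM])
    have "M \<subseteq> ?N" using subgroup.subset[OF subN] by simp
    moreover have "g \<in> ?N"
      by (rule maximal_abelian_normalizer[OF assms M(1) g(1) h])
    ultimately have "\<not> abelian_subgroup ?N G"
      using M(1) g(2) unfolding maximal_abelian_subgroup_def by blast
    moreover have "abelian_subgroup M (G\<lparr>carrier := ?N\<rparr>)"
      using subN abM by (simp add: abelian_subgroup_def)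
    ultimately show "\<exists>G0 H. subgroup G0 G \<and> \<not> abelian_subgroup G0 G \<and>
      H \<noteq> {\<one>\<^bsub>G\<^esub>} \<and> abelian_subgroup H (G\<lparr>carrier := G0\<rparr>) \<and> H \<lhd> (G\<lparr>carrier := G0\<rparr>)"
      using N normM h(1,2) by blast
  next
    assume "\<exists>G0 H. subgroup G0 G \<and> \<not> abelian_subgroup G0 G \<and>
      H \<noteq> {\<one>\<^bsub>G\<^esub>} \<and> abelian_subgroup H (G\<lparr>carrier := G0\<rparr>) \<and> H \<lhd> (G\<lparr>carrier := G0\<rparr>)"
    then obtain G0 H where G0: "subgroup G0 G" "\<not> abelian_subgroup G0 G"
      and H: "H \<noteq> {\<one>\<^bsub>G\<^esub>}" "abelian_subgroup H (G\<lparr>carrier := G0\<rparr>)" "H \<lhd> (G\<lparr>carrier := G0\<rparr>)"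
      by blast
    have subH: "subgroup H G"
      using H(2) incl_subgroup[OF G0(1)] by (simp add: abelian_subgroup_def)
    have abH: "abelian_subgroup H G"
      using H(2) subH by (simp add: abelian_subgroup_def)
    obtain h where h: "h \<in> H" "h \<noteq> \<one>\<^bsub>G\<^esub>"
      using H(1) subgroup.one_closed[OF subH] by blast
    have hG: "h \<in> carrier G" by (rule subgroup.mem_carrier[OF subH h(1)])
    let ?M = "centralizer G h"
    have maxM: "maximal_abelian_subgroup ?M G"
      by (rule maximal_abelian_centralizer[OF assms hG h(2)])
    have HM: "H \<subseteq> ?M" by (rule abelian_subgroup_le_centralizer[OF abH h(1)])
    have "\<not> G0 \<subseteq> ?M"
      using G0 abelian_centralizer[OF assms hG h(2)] by (auto simp: abelian_subgroup_iff)
    then obtain g where g: "g \<in> G0" "g \<notin> ?M" by blast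
    have gG: "g \<in> carrier G" by (rule subgroup.mem_carrier[OF G0(1) g(1)])
    have "g \<otimes>\<^bsub>G\<^esub> h \<otimes>\<^bsub>G\<^esub> inv\<^bsub>G\<^esub> g \<in> H"
      using normal.inv_op_closed2[OF H(3), of g h] g(1) h(1) G0(1) by simp
    then have "\<not> malnormal ?M G"
      using malnormalD[of ?M g h] gG g(2) h HM by blast
    then show "\<not> CSA_group G" using maxM by (auto simp: CSA_group_def)
  qed
qed

end
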